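(* For even $n\ge 2$ let $\mathcal P_n^{\mathrm{sq}}(z)$ be the partition function in $z$ of the strip of squares with $n$ black nodes on the torus. The recursion relation for it is $$\mathcal P_n^{\mathrm{sq}}(z)=\mathcal P_2^{\mathrm{sq}}(z)\,\mathcal P_{n-2}^{\mathrm{sq}}(z)-\mathcal P_{n-4}^{\mathrm{sq}}(z)$$ ($n\ge4$ even) with the initial conditions $$\mathcal P_0^{\mathrm{sq}}(z)=1,\qquad \mathcal P_2^{\mathrm{sq}}(z)=4-z-\frac1z.$$ The solution to this recursion is given by $$\mathcal P_n^{\mathrm{sq}}(z)=\frac{1}{(-4z)^{n/2}}\left[\left(z-1-\sqrt{1+z(z-6)}\right)^n+\left(z-1+\sqrt{1+z(z-6)}\right)^n\right].$$ This result is equivalent to $$\mathcal P_n^{\mathrm{sq}}(z)=z^{-n/2}\sum_{p=0}^n(-1)^pz^p\sum_{q=0}^p\frac{n\,(n-q-1)!}{q!\,(p-q)!\,(n-q-p)!}$$ (terms with $q>n-p$ being read as $0$) and provides a closed form.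
   Context: Strip of squares. For even $n\ge2$, the strip of squares $\mathcal G_{2,n}$ on the torus is the multigraph with $2n$ nodes $(r,j)$, $r\in\mathbb Z/2$ (row; $r=0$ bottom, $r=1$ top), $j\in\mathbb Z/n$ (column). Node $(r,j)$ is black if $r+j$ is even and white otherwise, so there are $n$ black nodes. There are $4n$ distinct edges (parallel edges count as different): horizontal edges $h_{r,j}$ joining $(r,j)$ and $(r,j+1)$, and vertical edges $v_{r,j}$ joining $(r,j)$ and $(r+1,j)$, where $v_{r,j}$ is thought of as going upwards from $(r,j)$; thus $v_{0,j}$ is internal and $v_{1,j}$ crosses the cycle $z$ of the torus. Weights. A perfect matching is a set of edges touching each node exactly once. Edges are directed from black to white. The $z$-weight $n_z$ of a matching $M$ is the sum over edges $v_{1,j}\in M$ of $+1$ if $(1,j)$ is black and $-1$ if $(1,j)$ is white. The $w$-weight $n_w$ of $M$ is the sum over edges $h_{r,n-1}\in M$ (those crossing the cycle $w$) of $+1$ if $(r,n-1)$ is black and $-1$ if $(r,n-1)$ is white. The weight of $M$ is the pair $(n_z,n_w)$. Partition functions. The full partition function (Newton polynomial) is $\sum_{n_z,n_w}N_{n_z,n_w}(-1)^{n_z+n_w+n_zn_w}z^{n_z}w^{n_w}$, where $N_{n_z,n_w}$ is the number of perfect matchings of weight $(n_z,n_w)$. The partition function in $z$, $\mathcal P_n^{\mathrm{sq}}(z)$, is its $w^0$ part.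
   Formalization: Two errors are corrected: in the recursion at n = 4 the term P_0 = 1 is replaced by 2 (in fact P_4 = P_2^2 - 2), and the prefactor z^(-n/2) of the double sum is replaced by (-z)^(-n/2) (as printed it gives -P_2 at n = 2). *)

theory Defs
  imports
    Complex_Main
    "HOL-Library.Poly_Mapping"
    "HOL-Library.Product_Plus"
begin

text \<open>
  Nodes are pairs (row, column) with row < 2 and column < n; the indices are the standard
  representatives of the residues mod 2 and mod n. An edge is an element of a datatype rather
  than a set of end points, so that parallel edges stay distinct (for n = 2 the edges
  \<open>Horiz r 0\<close> and \<open>Horiz r 1\<close> have the same ends, as do \<open>Vert 0 j\<close> and \<open>Vert 1 j\<close> for every n).
\<close>

type_synonym node = "nat \<times> nat"

datatype edge = Horiz nat nat | Vert nat nat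

definition strip_nodes :: "nat \<Rightarrow> node set" where
  "strip_nodes n = {..<2} \<times> {..<n}"

definition strip_edges :: "nat \<Rightarrow> edge set" where
  "strip_edges n = {Horiz r j | r j. r < 2 \<and> j < n} \<union> {Vert r j | r j. r < 2 \<and> j < n}"

fun edge_ends :: "nat \<Rightarrow> edge \<Rightarrow> node set" where
  "edge_ends n (Horiz r j) = {(r, j), (r, (j + 1) mod n)}"
| "edge_ends n (Vert r j) = {(r, j), ((r + 1) mod 2, j)}"

definition black :: "node \<Rightarrow> bool" where
  "black x \<longleftrightarrow> even (fst x + snd x)"

definition perfect_matching :: "nat \<Rightarrow> edge set \<Rightarrow> bool" where
  "perfect_matching n M \<longleftrightarrow>
     M \<subseteq> strip_edges n \<and> (\<forall>x \<in> strip_nodes n. \<exists>!e. e \<in> M \<and> x \<in> edge_ends n e)"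

definition z_weight :: "nat \<Rightarrow> edge set \<Rightarrow> int" where
  "z_weight n M = (\<Sum>j \<in> {j. j < n \<and> Vert 1 j \<in> M}. if black (1, j) then 1 else - 1)"

definition w_weight :: "nat \<Rightarrow> edge set \<Rightarrow> int" where
  "w_weight n M =
     (\<Sum>r \<in> {r. r < 2 \<and> Horiz r (n - 1) \<in> M}. if black (r, n - 1) then 1 else - 1)"

definition matching_count :: "nat \<Rightarrow> int \<Rightarrow> int \<Rightarrow> nat" where
  "matching_count n a b = card {M. perfect_matching n M \<and> z_weight n M = a \<and> w_weight n M = b}"

definition matching_weights :: "nat \<Rightarrow> (int \<times> int) set" where
  "matching_weights n = {(z_weight n M, w_weight n M) | M. perfect_matching n M}"

text \<open>
  Integer Laurent polynomials are elements of the group ring of \<open>int\<close> (one variable z) or of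
  \<open>int \<times> int\<close> (variables z and w); \<open>Poly_Mapping.single (a, b) c\<close> is the term \<open>c z^a w^b\<close>,
  and addition and multiplication are those of \<open>Poly_Mapping\<close>.
\<close>

type_synonym laurent = "int \<Rightarrow>\<^sub>0 int"
type_synonym laurent2 = "int \<times> int \<Rightarrow>\<^sub>0 int"

definition full_partition_function :: "nat \<Rightarrow> laurent2" where
  "full_partition_function n =
     (\<Sum>(a, b) \<in> matching_weights n.
        Poly_Mapping.single (a, b)
          (int (matching_count n a b) * (if even (a + b + a * b) then 1 else - 1)))"

definition w0_part :: "laurent2 \<Rightarrow> laurent" where
  "w0_part p = (\<Sum>k \<in> {k \<in> Poly_Mapping.keys p. snd k = 0}.
                  Poly_Mapping.single (fst k) (Poly_Mapping.lookup p k))"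

text \<open>
  For n = 0 the strip is the empty graph, whose only perfect matching is the empty one.
\<close>

definition P_sq :: "nat \<Rightarrow> laurent" where
  "P_sq n = w0_part (full_partition_function n)"

definition Z :: laurent where
  "Z = Poly_Mapping.single 1 1"

definition Z_inv :: laurent where
  "Z_inv = Poly_Mapping.single (- 1) 1"

definition laurent_eval :: "laurent \<Rightarrow> complex \<Rightarrow> complex" where
  "laurent_eval p z = (\<Sum>k \<in> Poly_Mapping.keys p. of_int (Poly_Mapping.lookup p k) * z powi k)"

end

theory Submission
  imports Defs
begin

text \<open>
  A matching of \<open>w\<close>-weight 0 is a tiling of the cycle of \<open>n\<close> columns by dominoes (pairs of parallel
  horizontal edges) and single columns with one of two vertical edges. Hence \<open>P_sq n\<close> is the
  generating function of these tilings, where a single column has weight \<open>1 - z\<close> or \<open>1 - 1/z\<close>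
  according to its parity. Cutting the cycle open gives linear tilings, which satisfy a
  three-term recursion with coefficients of period 2; eliminating the odd lengths gives the
  recursion in steps of 2. It is solved by the sums \<open>a ^ (n div 2) + b ^ (n div 2)\<close> with
  \<open>a + b = 4 - z - 1/z\<close> and \<open>a * b = 1\<close>, and Waring's formula for power sums of two variables
  yields the double sum.
\<close>

subsection \<open>Sums over sparse sets\<close>

text \<open>
  A set \<open>A\<close> stands for the tiling of a row of cells by the dominoes \<open>{j, j + 1}\<close> with \<open>j \<in> A\<close>
  and by single cells, where a single cell \<open>j\<close> has weight \<open>x j\<close>.
\<close>

definition sparse_sets :: "nat \<Rightarrow> nat \<Rightarrow> nat set set" where
  "sparse_sets a b = {A. (\<forall>j\<in>A. a \<le> j \<and> Suc j < b) \<and> (\<forall>j\<in>A. Suc j \<notin> A)}"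

definition free_cells :: "nat \<Rightarrow> nat \<Rightarrow> nat set \<Rightarrow> nat set" where
  "free_cells a b A = {j. a \<le> j \<and> j < b \<and> j \<notin> A \<and> (\<forall>i\<in>A. Suc i \<noteq> j)}"

definition tiling_sum :: "(nat \<Rightarrow> 'a::comm_ring_1) \<Rightarrow> nat \<Rightarrow> nat \<Rightarrow> 'a" where
  "tiling_sum x a b = (\<Sum>A\<in>sparse_sets a b. \<Prod>j\<in>free_cells a b A. x j)"

lemma finite_sparse_sets: "finite (sparse_sets a b)"
  by (rule finite_subset[of _ "Pow {..<b}"]) (auto simp: sparse_sets_def)

lemma finite_free_cells: "finite (free_cells a b A)"
  by (rule finite_subset[of _ "{..<b}"]) (auto simp: free_cells_def)

lemma inj_on_insert: "(\<And>A. A \<in> S \<Longrightarrow> b \<notin> A) \<Longrightarrow> inj_on (insert b) S"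
  by (meson inj_onI insert_ident)

lemma tiling_sum_empty: "tiling_sum x a a = 1"
proof -
  have "sparse_sets a a = {{}}" "free_cells a a {} = {}"
    by (auto simp: sparse_sets_def free_cells_def)
  then show ?thesis
    by (simp add: tiling_sum_def)
qed

lemma tiling_sum_singleton: "tiling_sum x a (Suc a) = x a"
proof -
  have "sparse_sets a (Suc a) = {{}}" "free_cells a (Suc a) {} = {a}"
    by (auto simp: sparse_sets_def free_cells_def)
  then show ?thesis
    by (simp add: tiling_sum_def)
qed

text \<open>The last cell \<open>b + 1\<close> is either single or the right half of the domino
  starting at \<open>b\<close>; removing it leaves the cells below \<open>b + 1\<close> or below
  \<open>b\<close>.\<close>

lemma tiling_sum_rec:
  assumes "a \<le> b"
  shows "tiling_sum x a (b + 2) = x (b + 1) * tiling_sum x a (b + 1) + tiling_sum x a b"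
proof -
  have split: "sparse_sets a (b + 2) = sparse_sets a (b + 1) \<union> insert b ` sparse_sets a b"
    (is "?L = ?R")
  proof (intro equalityI subsetI)
    fix A assume A: "A \<in> ?L"
    show "A \<in> ?R"
    proof (cases "b \<in> A")
      case True
      have "A - {b} \<in> sparse_sets a b"
        using A True unfolding sparse_sets_def
        by (auto simp: less_Suc_eq)
      moreover have "A = insert b (A - {b})"
        using True by auto
      ultimately show ?thesis
        by blast
    next
      case False
      then have "A \<in> sparse_sets a (b + 1)"
        using A unfolding sparse_sets_def by (auto simp: less_Suc_eq)
      then show ?thesis
        by blast
    qed
  next
    fix A assume "A \<in> ?R"
    then show "A \<in> ?L"
      using assms by (fastforce simp: sparse_sets_def)
  qed
  have disj: "sparse_sets a (b + 1) \<inter> insert b ` sparse_sets a b = {}"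
    by (auto simp: sparse_sets_def)
  have inj: "inj_on (insert b) (sparse_sets a b)"
    by (rule inj_on_insert) (auto simp: sparse_sets_def)
  have "(\<Prod>j\<in>free_cells a (b + 2) A. x j) = x (b + 1) * (\<Prod>j\<in>free_cells a (b + 1) A. x j)"
    if "A \<in> sparse_sets a (b + 1)" for A
  proof -
    have "free_cells a (b + 2) A = insert (b + 1) (free_cells a (b + 1) A)"
      using assms that by (auto simp: free_cells_def sparse_sets_def)
    moreover have "b + 1 \<notin> free_cells a (b + 1) A"
      by (simp add: free_cells_def)
    ultimately show ?thesis
      by (simp add: finite_free_cells)
  qed
  moreover have "free_cells a (b + 2) (insert b A) = free_cells a b A" if "A \<in> sparse_sets a b" for A
    using that by (auto simp: free_cells_def sparse_sets_def less_Suc_eq)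
  ultimately show ?thesis
    unfolding tiling_sum_def split
    by (subst sum.union_disjoint[OF _ _ disj])
      (simp_all add: finite_sparse_sets sum.reindex[OF inj] sum_distrib_left)
qed

text \<open>Three uses of the three-term recursion eliminate the lengths of the other parity. Period
  2 makes every product of adjacent weights equal to \<open>x 0 * x 1\<close>, and
  \<open>x (b + 3) = x (b + 1)\<close> lets the leftover odd term be traded for
  \<open>tiling_sum x a (b + 2) - tiling_sum x a b\<close>.\<close>

lemma tiling_sum_rec_periodic:
  assumes "a \<le> b" and "\<And>j. x (j + 2) = x j"
  shows "tiling_sum x a (b + 4) = (x 0 * x 1 + 2) * tiling_sum x a (b + 2) - tiling_sum x a b"
proof -
  have "x (b + 3) = x (b + 1)"
    using assms(2)[of "b + 1"] by (simp add: eval_nat_numeral)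
  have prod: "x (b + 2) * x (b + 1) = x 0 * x 1"
  proof (induction b)
    case (Suc b)
    have "x (Suc b + 2) * x (Suc b + 1) = x (b + 2) * x (b + 1)"
      using assms(2)[of "b + 1"] by (simp add: eval_nat_numeral)
    with Suc show ?case
      by simp
  qed (use assms(2)[of 0] in \<open>simp add: eval_nat_numeral\<close>)
  have "tiling_sum x a (b + 4) = x (b + 3) * tiling_sum x a (b + 3) + tiling_sum x a (b + 2)"
    using tiling_sum_rec[of a "b + 2" x] assms(1) by (simp add: eval_nat_numeral)
  moreover have "tiling_sum x a (b + 3) = x (b + 2) * tiling_sum x a (b + 2) + tiling_sum x a (b + 1)"
    using tiling_sum_rec[of a "b + 1" x] assms(1) by (simp add: eval_nat_numeral)
  moreover note tiling_sum_rec[OF assms(1), of x] \<open>x (b + 3) = x (b + 1)\<close>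
  ultimately have "tiling_sum x a (b + 4) =
      x (b + 2) * x (b + 1) * tiling_sum x a (b + 2) + x (b + 1) * tiling_sum x a (b + 1)
        + tiling_sum x a (b + 2)"
    by (simp add: algebra_simps)
  also have "x (b + 1) * tiling_sum x a (b + 1) = tiling_sum x a (b + 2) - tiling_sum x a b"
    using tiling_sum_rec[OF assms(1), of x] by simp
  finally show ?thesis
    unfolding prod by (simp add: algebra_simps)
qed

section \<open>Tilings of a cycle of cells\<close>

definition cyclic_sparse_sets :: "nat \<Rightarrow> nat set set" where
  "cyclic_sparse_sets n = {A. A \<subseteq> {..<n} \<and> (\<forall>j\<in>A. Suc j mod n \<notin> A)}"

definition cyclic_free_cells :: "nat \<Rightarrow> nat set \<Rightarrow> nat set" where
  "cyclic_free_cells n A = {j. j < n \<and> j \<notin> A \<and> (\<forall>i\<in>A. Suc i mod n \<noteq> j)}"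

definition cyclic_tiling_sum :: "(nat \<Rightarrow> 'a::comm_ring_1) \<Rightarrow> nat \<Rightarrow> 'a" where
  "cyclic_tiling_sum x n = (\<Sum>A\<in>cyclic_sparse_sets n. \<Prod>j\<in>cyclic_free_cells n A. x j)"

text \<open>The cycle is cut between the cells \<open>n - 1\<close> and 0. Either no domino crosses
  the cut, or one does, and without it the cells 1 to \<open>n - 2\<close> remain. In the proof
  \<open>m + 1\<close> is the last cell, the only one whose successor wraps around.\<close>

lemma cyclic_tiling_sum_split:
  assumes "n \<ge> 2"
  shows "cyclic_tiling_sum x n = tiling_sum x 0 n + tiling_sum x 1 (n - 1)"
proof -
  obtain m where n: "n = m + 2"
    using assms by (metis add.commute le_Suc_ex)
  have mod_n: "Suc j mod n = (if j = m + 1 then 0 else Suc j)" if "j < n" for j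
    using that n by auto
  have split: "cyclic_sparse_sets n = sparse_sets 0 n \<union> insert (m + 1) ` sparse_sets 1 (n - 1)"
    (is "?L = ?R")
  proof (intro equalityI subsetI)
    fix A assume A: "A \<in> ?L"
    have lt: "j < n" and nxt: "(if j = m + 1 then 0 else Suc j) \<notin> A" if "j \<in> A" for j
      using A that mod_n[of j] unfolding cyclic_sparse_sets_def by force+
    show "A \<in> ?R"
    proof (cases "m + 1 \<in> A")
      case True
      have "1 \<le> j \<and> Suc j < n - 1 \<and> Suc j \<notin> A" if "j \<in> A - {m + 1}" for j
      proof -
        have "0 \<notin> A" using nxt[OF True] by simp
        then have "j \<noteq> 0" using that by (metis DiffD1)
        moreover have "Suc j \<notin> A" using nxt[of j] that by auto
        moreover have "j \<noteq> m" using \<open>Suc j \<notin> A\<close> True by auto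
        moreover have "j < n" using lt that by auto
        ultimately show ?thesis using that n by auto
      qed
      then have "A - {m + 1} \<in> sparse_sets 1 (n - 1)"
        unfolding sparse_sets_def by auto
      moreover have "A = insert (m + 1) (A - {m + 1})"
        using True by auto
      ultimately show ?thesis
        by blast
    next
      case False
      have "Suc j < n \<and> Suc j \<notin> A" if "j \<in> A" for j
        using lt[OF that] nxt[OF that] that False n by (cases "j = m + 1") auto
      then have "A \<in> sparse_sets 0 n"
        unfolding sparse_sets_def by auto
      then show ?thesis
        by blast
    qed
  next
    fix A assume "A \<in> ?R"
    then show "A \<in> ?L"
    proof
      assume "A \<in> sparse_sets 0 n"
      then show ?thesis
        unfolding sparse_sets_def cyclic_sparse_sets_def by fastforce
    next
      assume "A \<in> insert (m + 1) ` sparse_sets 1 (n - 1)"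
      then obtain B where B: "B \<in> sparse_sets 1 (n - 1)" and A: "A = insert (m + 1) B"
        by blast
      have B': "1 \<le> j" "j < m" "Suc j \<notin> B" if "j \<in> B" for j
        using B that n unfolding sparse_sets_def by auto
      have "j < n \<and> Suc j mod n \<notin> A" if "j \<in> A" for j
      proof (cases "j = m + 1")
        case True
        then show ?thesis using n A B'(1)[of 0] by auto
      next
        case False
        with that A have "j \<in> B" by simp
        from B'[OF this] show ?thesis using n A by auto
      qed
      then show ?thesis
        unfolding cyclic_sparse_sets_def by auto
    qed
  qed
  have disj: "sparse_sets 0 n \<inter> insert (m + 1) ` sparse_sets 1 (n - 1) = {}"
    by (auto simp: sparse_sets_def n)
  have inj: "inj_on (insert (m + 1)) (sparse_sets 1 (n - 1))"
    by (rule inj_on_insert) (auto simp: sparse_sets_def n)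
  have "cyclic_free_cells n A = free_cells 0 n A" if "A \<in> sparse_sets 0 n" for A
  proof -
    have "Suc i mod n = Suc i" if "i \<in> A" for i
      using that \<open>A \<in> sparse_sets 0 n\<close> by (auto simp: sparse_sets_def)
    then show ?thesis
      by (auto simp: free_cells_def cyclic_free_cells_def)
  qed
  moreover have "cyclic_free_cells n (insert (m + 1) A) = free_cells 1 (n - 1) A"
    if "A \<in> sparse_sets 1 (n - 1)" for A
  proof -
    have "Suc i mod n = Suc i" if "i \<in> A" for i
      using that \<open>A \<in> sparse_sets 1 (n - 1)\<close> by (auto simp: sparse_sets_def n)
    moreover have "Suc (m + 1) mod n = 0"
      by (simp add: n)
    ultimately show ?thesis
      by (auto simp: free_cells_def cyclic_free_cells_def n)
  qed
  ultimately show ?thesis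
    unfolding cyclic_tiling_sum_def tiling_sum_def split
    by (subst sum.union_disjoint[OF _ _ disj])
      (simp_all add: finite_sparse_sets sum.reindex[OF inj, simplified])
qed

text \<open>The 2 counts \<open>{0}\<close> and \<open>{1}\<close>, different dominoes on the same
  two cells; they correspond to the parallel horizontal edges.\<close>

lemma cyclic_tiling_sum_2: "cyclic_tiling_sum x 2 = x 0 * x 1 + 2"
  using tiling_sum_rec[of 0 0 x]
  by (simp add: cyclic_tiling_sum_split tiling_sum_empty[of x] tiling_sum_singleton[of x 0, simplified]
      mult.commute numeral_2_eq_2[symmetric])

text \<open>Both linear sums of the cut cycle obey the same recursion. Continued back to
  \<open>n = 0\<close>, each of them takes the value 1, so the exceptional term is 2, whereas the
  empty cycle has the single tiling \<open>{}\<close>.\<close>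

lemma cyclic_tiling_sum_rec:
  assumes "even n" "n \<ge> 4" and periodic: "\<And>j. x (j + 2) = x j"
  shows "cyclic_tiling_sum x n = cyclic_tiling_sum x 2 * cyclic_tiling_sum x (n - 2) -
           (if n = 4 then 2 else cyclic_tiling_sum x (n - 4))"
proof (cases "n = 4")
  case True
  have "tiling_sum x 1 3 = x 2 * x 1 + 1" "tiling_sum x 0 2 = x 0 * x 1 + 1"
    using tiling_sum_rec[of 1 1 x] tiling_sum_rec[of 0 0 x]
      tiling_sum_singleton[of x 0] tiling_sum_singleton[of x 1]
    by (simp_all add: tiling_sum_empty numeral_2_eq_2 numeral_3_eq_3 mult.commute)
  moreover have "x 2 = x 0"
    using periodic[of 0] by (simp add: numeral_2_eq_2)
  moreover have "tiling_sum x 0 4 = (x 0 * x 1 + 2) * tiling_sum x 0 2 - 1"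
    using tiling_sum_rec_periodic[of 0 0 x, OF _ periodic]
    by (simp add: tiling_sum_empty numeral_2_eq_2)
  ultimately show ?thesis
    using cyclic_tiling_sum_split[of 4 x]
    by (simp add: True cyclic_tiling_sum_2 algebra_simps)
next
  case False
  with assms(1,2) have "n \<ge> 6"
    by presburger
  define m where "m = n - 6"
  have n: "n = m + 6" "n - 2 = m + 4" "n - 4 = m + 2"
    using \<open>n \<ge> 6\<close> by (auto simp: m_def)
  have split: "cyclic_tiling_sum x (m + 6) = tiling_sum x 0 (m + 6) + tiling_sum x 1 (m + 5)"
    "cyclic_tiling_sum x (m + 4) = tiling_sum x 0 (m + 4) + tiling_sum x 1 (m + 3)"
    "cyclic_tiling_sum x (m + 2) = tiling_sum x 0 (m + 2) + tiling_sum x 1 (m + 1)"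
    using cyclic_tiling_sum_split[of "m + 6" x] cyclic_tiling_sum_split[of "m + 4" x]
      cyclic_tiling_sum_split[of "m + 2" x] by (simp_all add: add.commute[of m])
  have e: "m + 2 + 4 = m + 6" "m + 2 + 2 = m + 4" "m + 1 + 4 = m + 5" "m + 1 + 2 = m + 3"
    by simp_all
  have "tiling_sum x 0 (m + 6) = (x 0 * x 1 + 2) * tiling_sum x 0 (m + 4) - tiling_sum x 0 (m + 2)"
    "tiling_sum x 1 (m + 5) = (x 0 * x 1 + 2) * tiling_sum x 1 (m + 3) - tiling_sum x 1 (m + 1)"
    using tiling_sum_rec_periodic[of 0 "m + 2" x, OF _ periodic]
      tiling_sum_rec_periodic[of 1 "m + 1" x, OF _ periodic]
    unfolding e by simp_all
  then have "cyclic_tiling_sum x (m + 6) =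
      cyclic_tiling_sum x 2 * cyclic_tiling_sum x (m + 4) - cyclic_tiling_sum x (m + 2)"
    unfolding split cyclic_tiling_sum_2 by (simp add: algebra_simps)
  with False show ?thesis
    unfolding n(2,3) by (simp add: n(1))
qed

subsection \<open>Matchings of \<open>w\<close>-weight 0\<close>

lemma strip_edges_iff:
  "Horiz r j \<in> strip_edges n \<longleftrightarrow> r < 2 \<and> j < n"
  "Vert r j \<in> strip_edges n \<longleftrightarrow> r < 2 \<and> j < n"
  by (auto simp: strip_edges_def)

lemma finite_strip_edges: "finite (strip_edges n)"
proof -
  have "strip_edges n = case_prod Horiz ` ({..<2} \<times> {..<n}) \<union> case_prod Vert ` ({..<2} \<times> {..<n})"
    by (auto simp: strip_edges_def)
  then show ?thesis
    by simp
qed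

lemma finite_perfect_matchings: "finite {M. perfect_matching n M}"
  by (rule finite_subset[of _ "Pow (strip_edges n)"])
    (auto simp: perfect_matching_def finite_strip_edges)

lemma incident_iff:
  assumes "e \<in> strip_edges n" "r < 2" "j < n"
  shows "(r, j) \<in> edge_ends n e \<longleftrightarrow>
    (\<exists>i. e = Horiz r i \<and> (i = j \<or> Suc i mod n = j)) \<or> e = Vert 0 j \<or> e = Vert 1 j"
  using assms by (cases e) (auto simp: strip_edges_iff less_2_cases_iff)

text \<open>The cyclic successor is a bijection of the columns; this form names the column to the
  left of \<open>j\<close>.\<close>

lemma ex_cyclic_pred:
  assumes "j < n"
  obtains i where "i < n" "\<And>k. k < n \<Longrightarrow> Suc k mod n = j \<longleftrightarrow> k = i"
proof (cases j)
  case 0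
  have "Suc k mod n = j \<longleftrightarrow> k = n - 1" if "k < n" for k
    using that 0 by (cases "Suc k = n") auto
  with assms show ?thesis
    by (intro that[of "n - 1"]) auto
next
  case (Suc i)
  have "Suc k mod n = j \<longleftrightarrow> k = i" if "k < n" for k
    using that Suc assms by (cases "Suc k = n") auto
  with assms Suc show ?thesis
    by (intro that[of i]) auto
qed

lemma ex1_in_four_iff:
  assumes "distinct [a, b, c, d]"
  shows "(\<exists>!e. e \<in> M \<and> e \<in> {a, b, c, d}) \<longleftrightarrow>
    (a \<in> M \<or> b \<in> M \<or> c \<in> M \<or> d \<in> M) \<and>
    (a \<in> M \<longrightarrow> b \<notin> M \<and> c \<notin> M \<and> d \<notin> M) \<and> (b \<in> M \<longrightarrow> c \<notin> M \<and> d \<notin> M) \<and> (c \<in> M \<longrightarrow> d \<notin> M)"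
  using assms unfolding Ex1_def by auto

text \<open>A node is addressed through the column \<open>i\<close> to its left, so that its four
  incident edges can be listed explicitly and the covering condition becomes propositional.\<close>

lemma perfect_matching_iff:
  "perfect_matching n M \<longleftrightarrow> M \<subseteq> strip_edges n \<and>
    (\<forall>r<2. \<forall>i<n. \<forall>j. j = Suc i mod n \<longrightarrow>
       (\<exists>!e. e \<in> M \<and> e \<in> {Horiz r i, Horiz r j, Vert 0 j, Vert 1 j}))"
proof -
  have ends: "(\<exists>!e. e \<in> M \<and> (r, j) \<in> edge_ends n e) \<longleftrightarrow>
      (\<exists>!e. e \<in> M \<and> e \<in> {Horiz r i, Horiz r j, Vert 0 j, Vert 1 j})"
    if "M \<subseteq> strip_edges n" "r < 2" "i < n" "j = Suc i mod n" for r i j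
  proof -
    have j: "j < n"
      using that by simp
    then obtain i' where i': "\<And>k. k < n \<Longrightarrow> Suc k mod n = j \<longleftrightarrow> k = i'"
      by (rule ex_cyclic_pred) blast
    with that have "i' = i"
      by blast
    have "(r, j) \<in> edge_ends n e \<longleftrightarrow> e \<in> {Horiz r i, Horiz r j, Vert 0 j, Vert 1 j}" if "e \<in> M" for e
    proof -
      from that \<open>M \<subseteq> strip_edges n\<close> have e: "e \<in> strip_edges n"
        by blast
      show ?thesis
        unfolding incident_iff[OF e \<open>r < 2\<close> j]
        using e i' \<open>i' = i\<close> \<open>i < n\<close> by (cases e) (auto simp: strip_edges_iff)
    qed
    then show ?thesis
      by metis
  qed
  have nodes: "(\<forall>x\<in>strip_nodes n. P x) \<longleftrightarrow> (\<forall>r<2. \<forall>i<n. \<forall>j. j = Suc i mod n \<longrightarrow> P (r, j))" for P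
  proof (intro iffI allI impI ballI)
    fix x assume P: "\<forall>r<2. \<forall>i<n. \<forall>j. j = Suc i mod n \<longrightarrow> P (r, j)" and "x \<in> strip_nodes n"
    then obtain r j where x: "x = (r, j)" "r < 2" "j < n"
      by (auto simp: strip_nodes_def)
    obtain i where "i < n" "\<And>k. k < n \<Longrightarrow> Suc k mod n = j \<longleftrightarrow> k = i"
      using ex_cyclic_pred[OF \<open>j < n\<close>] by blast
    with P x show "P x"
      by metis
  qed (auto simp: strip_nodes_def)
  show ?thesis
    unfolding perfect_matching_def nodes by (intro conj_cong refl iff_allI imp_cong ends)
qed

text \<open>
  The columns \<open>j\<close>, \<open>j + 1\<close> with \<open>j \<in> A\<close> carry pairs of horizontal edges; the set \<open>U\<close> consists of
  the remaining columns in which the vertical edge crosses the cycle \<open>z\<close>.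
\<close>

definition tiling_matching :: "nat \<Rightarrow> nat set \<times> nat set \<Rightarrow> edge set" where
  "tiling_matching n = (\<lambda>(A, U). {Horiz r j | r j. r < 2 \<and> j \<in> A} \<union> {Vert 1 j | j. j \<in> U} \<union>
     {Vert 0 j | j. j \<in> cyclic_free_cells n A - U})"

lemma tiling_matching_iff:
  "Horiz r j \<in> tiling_matching n (A, U) \<longleftrightarrow> r < 2 \<and> j \<in> A"
  "Vert r j \<in> tiling_matching n (A, U) \<longleftrightarrow> r = 1 \<and> j \<in> U \<or> r = 0 \<and> j \<in> cyclic_free_cells n A - U"
  by (auto simp: tiling_matching_def)

text \<open>The two nodes of column \<open>n - 1\<close> have opposite colours, so the two possible
  contributions have opposite signs.\<close>

lemma w_weight_eq_0_iff:
  "w_weight n M = 0 \<longleftrightarrow> (Horiz 0 (n - 1) \<in> M \<longleftrightarrow> Horiz 1 (n - 1) \<in> M)"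
proof -
  have "{r. r < 2 \<and> Horiz r (n - 1) \<in> M} = {r \<in> {0, 1}. Horiz r (n - 1) \<in> M}"
    by auto
  then have "w_weight n M =
      (\<Sum>r\<in>{0, 1}. if Horiz r (n - 1) \<in> M then if black (r, n - 1) then 1 else - 1 else 0)"
    unfolding w_weight_def by (simp only: sum.inter_filter finite.intros)
  then show ?thesis
    by (auto simp: black_def)
qed

lemma perfect_matching_tiling_matching:
  assumes "n \<ge> 2" "A \<in> cyclic_sparse_sets n" "U \<subseteq> cyclic_free_cells n A"
  shows "perfect_matching n (tiling_matching n (A, U))"
proof -
  have "\<exists>!e. e \<in> tiling_matching n (A, U) \<and> e \<in> {Horiz r i, Horiz r j, Vert 0 j, Vert 1 j}"
    if "r < 2" "i < n" "j = Suc i mod n" for r i j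
  proof -
    have "j < n" "i \<noteq> j"
      using that assms(1) by (auto simp: mod_Suc)
    have free: "j \<in> cyclic_free_cells n A \<longleftrightarrow> j \<notin> A \<and> i \<notin> A"
    proof -
      obtain i' where "\<And>k. k < n \<Longrightarrow> Suc k mod n = j \<longleftrightarrow> k = i'"
        using ex_cyclic_pred[OF \<open>j < n\<close>] by metis
      with that \<open>j < n\<close> assms(2) show ?thesis
        by (auto simp: cyclic_free_cells_def cyclic_sparse_sets_def)
    qed
    have "i \<in> A \<Longrightarrow> j \<notin> A"
      using that assms(2) by (auto simp: cyclic_sparse_sets_def)
    \<comment> \<open>Column \<open>j\<close> is the right half of a domino, the left half of a
      domino, or a single column.\<close>
    then consider "i \<in> A" "j \<notin> A" "j \<notin> cyclic_free_cells n A" "j \<notin> U"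
      | "j \<in> A" "i \<notin> A" "j \<notin> cyclic_free_cells n A" "j \<notin> U"
      | "j \<in> cyclic_free_cells n A" "i \<notin> A" "j \<notin> A"
      using free assms(3) by blast
    moreover have "distinct [Horiz r i, Horiz r j, Vert 0 j, Vert 1 j]"
      using \<open>i \<noteq> j\<close> by simp
    ultimately show ?thesis
      using \<open>r < 2\<close> assms(3) unfolding ex1_in_four_iff[OF \<open>distinct _\<close>]
      by cases (auto simp: tiling_matching_iff)
  qed
  moreover have "tiling_matching n (A, U) \<subseteq> strip_edges n"
    using assms(2,3)
    by (auto simp: tiling_matching_def strip_edges_def cyclic_sparse_sets_def cyclic_free_cells_def)
  ultimately show ?thesis
    unfolding perfect_matching_iff by blast
qed

text \<open>
  Each column contains one node of each colour, so the flow of the matching through the cuts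
  between consecutive columns is constant; if it is 0, each cut is crossed by both
  horizontal edges or by none.
\<close>

lemma perfect_matching_Horiz_iff:
  assumes "n \<ge> 2" "perfect_matching n M" "w_weight n M = 0" "j < n"
  shows "Horiz 0 j \<in> M \<longleftrightarrow> Horiz 1 j \<in> M"
proof -
  have step: "Horiz 0 (Suc i mod n) \<in> M \<longleftrightarrow> Horiz 1 (Suc i mod n) \<in> M"
    if "i < n" "Horiz 0 i \<in> M \<longleftrightarrow> Horiz 1 i \<in> M" for i
  proof -
    define k where "k = Suc i mod n"
    have "i \<noteq> k"
      using assms(1) \<open>i < n\<close> by (auto simp: k_def mod_Suc)
    have ex1: "\<exists>!e. e \<in> M \<and> e \<in> {Horiz r i, Horiz r k, Vert 0 k, Vert 1 k}" if "r < 2" for r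
      using assms(1,2) \<open>i < n\<close> that unfolding perfect_matching_iff k_def by blast
    \<comment> \<open>Vertical edges at \<open>k\<close> serve both rows. Two incoming horizontal
      edges already cover the column; with none, either a vertical edge covers both nodes or both
      must be left by an outgoing edge.\<close>
    show ?thesis
      using ex1[of 0] ex1[of 1] \<open>i \<noteq> k\<close> that(2) unfolding k_def[symmetric]
      by (cases "Horiz 0 i \<in> M"; cases "Vert 0 k \<in> M"; cases "Vert 1 k \<in> M") auto
  qed
  \<comment> \<open>The weight condition gives agreement at the cut after column
    \<open>n - 1\<close>; going once around the cycle, it starts the induction at column 0.\<close>
  have last: "Horiz 0 (n - 1) \<in> M \<longleftrightarrow> Horiz 1 (n - 1) \<in> M"
    using assms(3) by (simp only: w_weight_eq_0_iff)
  show ?thesis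
    using assms(4)
  proof (induction j)
    case 0
    with step[of "n - 1"] last assms(1) show ?case
      by simp
  next
    case (Suc j)
    with step[of j] show ?case
      by simp
  qed
qed

text \<open>Since the two rows agree, the bottom row determines all horizontal edges, and the
  covering conditions at the bottom nodes determine the rest.\<close>

lemma perfect_matching_eq_tiling_matching:
  assumes "n \<ge> 2" "perfect_matching n M" "w_weight n M = 0"
  defines "A \<equiv> {j. Horiz 0 j \<in> M}" and "U \<equiv> {j. Vert 1 j \<in> M}"
  shows "A \<in> cyclic_sparse_sets n" "U \<subseteq> cyclic_free_cells n A" "M = tiling_matching n (A, U)"
proof -
  have sub: "M \<subseteq> strip_edges n"
    using assms(2) by (simp add: perfect_matching_def)
  have Horiz: "Horiz r j \<in> M \<longleftrightarrow> r < 2 \<and> j \<in> A" for r j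
  proof -
    have "j < n" "r < 2" if "Horiz r j \<in> M" for r j
      using that sub strip_edges_iff by blast+
    then show ?thesis
      using perfect_matching_Horiz_iff[OF assms(1-3), of j] unfolding A_def
      by (auto simp: less_2_cases_iff)
  qed
  have A_lt: "j < n" if "j \<in> A" for j
    using that sub by (auto simp: A_def strip_edges_iff)
  have ex1: "\<exists>!e. e \<in> M \<and> e \<in> {Horiz 0 i, Horiz 0 j, Vert 0 j, Vert 1 j}"
    if "i < n" "j = Suc i mod n" for i j
    using assms(1,2) that unfolding perfect_matching_iff by simp
  have neq: "i \<noteq> Suc i mod n" if "i < n" for i
    using that assms(1) by (auto simp: mod_Suc)
  show A: "A \<in> cyclic_sparse_sets n"
  proof -
    have "Suc i mod n \<notin> A" if "i \<in> A" for i
      using ex1[OF A_lt[OF that] refl] neq[OF A_lt[OF that]] that unfolding A_def by auto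
    with A_lt show ?thesis
      by (auto simp: cyclic_sparse_sets_def)
  qed
  have free: "j \<in> cyclic_free_cells n A \<longleftrightarrow> j \<notin> A \<and> i \<notin> A" if "i < n" "j = Suc i mod n" for i j
  proof -
    have "j < n"
      using that by simp
    obtain i' where "\<And>k. k < n \<Longrightarrow> Suc k mod n = j \<longleftrightarrow> k = i'"
      using ex_cyclic_pred[OF \<open>j < n\<close>] by metis
    with that \<open>j < n\<close> A_lt show ?thesis
      by (auto simp: cyclic_free_cells_def)
  qed
  \<comment> \<open>A free column contains exactly one of its two vertical edges, any other column
    contains neither.\<close>
  have U: "j \<in> U \<longleftrightarrow> j \<in> cyclic_free_cells n A \<and> Vert 0 j \<notin> M"
    and V: "Vert 0 j \<in> M \<longleftrightarrow> j \<in> cyclic_free_cells n A - U" if "j < n" for j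
  proof -
    obtain i where i: "i < n" "j = Suc i mod n"
      using ex_cyclic_pred[OF \<open>j < n\<close>] by metis
    show "j \<in> U \<longleftrightarrow> j \<in> cyclic_free_cells n A \<and> Vert 0 j \<notin> M"
      "Vert 0 j \<in> M \<longleftrightarrow> j \<in> cyclic_free_cells n A - U"
      using ex1[OF i] neq[OF i(1)] ex1_in_four_iff[of "Horiz 0 i" "Horiz 0 j" "Vert 0 j" "Vert 1 j" M]
      unfolding Diff_iff free[OF i] unfolding U_def A_def i(2)[symmetric] by auto
  qed
  have "j < n" if "Vert r j \<in> M" for r j
    using that sub strip_edges_iff by blast
  then show "U \<subseteq> cyclic_free_cells n A"
    using U by (auto simp: U_def)
  show "M = tiling_matching n (A, U)"
  proof (rule set_eqI)
    fix e
    show "e \<in> M \<longleftrightarrow> e \<in> tiling_matching n (A, U)"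
    proof (cases e)
      case (Horiz r j)
      then show ?thesis
        using \<open>Horiz r j \<in> M \<longleftrightarrow> r < 2 \<and> j \<in> A\<close> by (simp add: tiling_matching_iff)
    next
      case (Vert r j)
      have "r = 0 \<or> r = 1" if "Vert r j \<in> M"
      proof -
        have "Vert r j \<in> strip_edges n"
          using that sub by blast
        then show ?thesis
          by (auto simp: strip_edges_iff)
      qed
      moreover have "j < n" if "j \<in> cyclic_free_cells n A"
        using that by (simp add: cyclic_free_cells_def)
      ultimately show ?thesis
        using V[of j] \<open>\<And>r j. Vert r j \<in> M \<Longrightarrow> j < n\<close> Vert
        by (auto simp: tiling_matching_iff U_def)
    qed
  qed
qed

text \<open>For a fixed \<open>A\<close> the choice of \<open>U\<close> is an arbitrary subset of
  the free columns; this independence is what makes the weights factor over columns.\<close>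

lemma bij_betw_tiling_matching:
  assumes "n \<ge> 2"
  shows "bij_betw (tiling_matching n) (SIGMA A:cyclic_sparse_sets n. Pow (cyclic_free_cells n A))
           {M. perfect_matching n M \<and> w_weight n M = 0}"
proof (rule bij_betw_byWitness[where f' = "\<lambda>M. ({j. Horiz 0 j \<in> M}, {j. Vert 1 j \<in> M})"])
  show "tiling_matching n ` (SIGMA A:cyclic_sparse_sets n. Pow (cyclic_free_cells n A))
      \<subseteq> {M. perfect_matching n M \<and> w_weight n M = 0}"
    using perfect_matching_tiling_matching[OF assms]
    by (auto simp: w_weight_eq_0_iff tiling_matching_iff)
  show "\<forall>M\<in>{M. perfect_matching n M \<and> w_weight n M = 0}.
      tiling_matching n ({j. Horiz 0 j \<in> M}, {j. Vert 1 j \<in> M}) = M"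
    using perfect_matching_eq_tiling_matching(3)[OF assms, symmetric] by blast
  show "(\<lambda>M. ({j. Horiz 0 j \<in> M}, {j. Vert 1 j \<in> M})) ` {M. perfect_matching n M \<and> w_weight n M = 0}
      \<subseteq> (SIGMA A:cyclic_sparse_sets n. Pow (cyclic_free_cells n A))"
    using perfect_matching_eq_tiling_matching(1,2)[OF assms] by blast
qed (auto simp: tiling_matching_iff)

subsection \<open>The partition function as a sum over tilings\<close>

lemma lookup_full_partition_function:
  "Poly_Mapping.lookup (full_partition_function n) (a, b) =
     int (matching_count n a b) * (if even (a + b + a * b) then 1 else - 1)"
proof -
  have "matching_weights n = (\<lambda>M. (z_weight n M, w_weight n M)) ` {M. perfect_matching n M}"
    by (auto simp: matching_weights_def)
  then have fin: "finite (matching_weights n)"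
    by (simp add: finite_perfect_matchings)
  have "matching_count n a b = 0" if "(a, b) \<notin> matching_weights n"
  proof -
    have "{M. perfect_matching n M \<and> z_weight n M = a \<and> w_weight n M = b} = {}"
      using that by (auto simp: matching_weights_def)
    then show ?thesis
      unfolding matching_count_def by (simp only: card.empty)
  qed
  then show ?thesis
    unfolding full_partition_function_def
    using fin by (auto simp: lookup_sum lookup_single case_prod_unfold when_def)
qed

lemma lookup_w0_part: "Poly_Mapping.lookup (w0_part p) k = Poly_Mapping.lookup p (k, 0)"
proof -
  have "Poly_Mapping.lookup (w0_part p) k =
      (\<Sum>x \<in> {x \<in> Poly_Mapping.keys p. snd x = 0}. if x = (k, 0) then Poly_Mapping.lookup p x else 0)"
    unfolding w0_part_def lookup_sum
    by (intro sum.cong) (auto simp: lookup_single when_def)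
  also have "\<dots> = Poly_Mapping.lookup p (k, 0)"
    by (subst sum.delta) (auto simp: in_keys_iff)
  finally show ?thesis .
qed

text \<open>For \<open>w\<close>-weight 0 the exponent of the sign reduces to the
  \<open>z\<close>-weight, and the grouping of matchings by weight is undone.\<close>

lemma P_sq_eq_matching_sum:
  "P_sq n = (\<Sum>M | perfect_matching n M \<and> w_weight n M = 0.
     Poly_Mapping.single (z_weight n M) (if even (z_weight n M) then 1 else - 1))"
proof (rule poly_mapping_eqI)
  fix k
  have fin: "finite {M. perfect_matching n M \<and> w_weight n M = 0}"
    by (rule finite_subset[OF _ finite_perfect_matchings[of n]]) auto
  have "{M. perfect_matching n M \<and> z_weight n M = k \<and> w_weight n M = 0} =
      {M \<in> {M. perfect_matching n M \<and> w_weight n M = 0}. z_weight n M = k}"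
    by auto
  then have "int (matching_count n k 0) =
      (\<Sum>M | perfect_matching n M \<and> w_weight n M = 0. if z_weight n M = k then 1 else 0)"
    unfolding matching_count_def using fin by (simp add: sum.If_cases Int_def)
  then show "Poly_Mapping.lookup (P_sq n) k =
      Poly_Mapping.lookup (\<Sum>M | perfect_matching n M \<and> w_weight n M = 0.
        Poly_Mapping.single (z_weight n M) (if even (z_weight n M) then 1 else - 1)) k"
    by (auto simp: P_sq_def lookup_w0_part lookup_full_partition_function lookup_sum lookup_single
        when_def sum_distrib_right intro!: sum.cong)
qed

text \<open>The 1 stands for the internal vertical edge, the other term for the crossing one with
  its share of the sign; \<open>(1, j)\<close> is black exactly for odd \<open>j\<close>.\<close>

definition column_weight :: "nat \<Rightarrow> laurent" where
  "column_weight j = (if odd j then 1 - Z else 1 - Z_inv)"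

lemma single_z_weight_tiling_matching:
  assumes "finite U" "U \<subseteq> {..<n}"
  shows "(let a = z_weight n (tiling_matching n (A, U))
          in Poly_Mapping.single a (if even a then 1 else - 1 :: int)) = (\<Prod>j\<in>U. column_weight j - 1)"
proof -
  have "z_weight n (tiling_matching n (A, U)) = (\<Sum>j\<in>U. if odd j then 1 else - 1)"
    unfolding z_weight_def using assms(2)
    by (intro sum.cong) (auto simp: tiling_matching_iff black_def)
  moreover have "(let a = (\<Sum>j\<in>U. if odd j then 1 else - 1 :: int)
      in Poly_Mapping.single a (if even a then 1 else - 1 :: int)) = (\<Prod>j\<in>U. column_weight j - 1)"
    using assms(1)
  proof (induction U rule: finite_induct)
    case empty
    then show ?case by (simp add: Let_def)
  next
    case (insert i U)
    show ?case
      unfolding prod.insert[OF insert.hyps] insert.IH[symmetric] sum.insert[OF insert.hyps]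
      by (auto simp: Let_def column_weight_def Z_def Z_inv_def mult_single simp flip: single_uminus)
  qed
  ultimately show ?thesis
    by simp
qed

lemma P_sq_eq_cyclic_tiling_sum:
  assumes "n \<ge> 2"
  shows "P_sq n = cyclic_tiling_sum column_weight n"
proof -
  have fin: "finite (cyclic_free_cells n A)" "cyclic_free_cells n A \<subseteq> {..<n}" for A
    by (auto simp: cyclic_free_cells_def)
  have fin': "finite (cyclic_sparse_sets n)"
    by (rule finite_subset[of _ "Pow {..<n}"]) (auto simp: cyclic_sparse_sets_def)
  have "P_sq n = (\<Sum>(A, U)\<in>(SIGMA A:cyclic_sparse_sets n. Pow (cyclic_free_cells n A)).
      let a = z_weight n (tiling_matching n (A, U))
      in Poly_Mapping.single a (if even a then 1 else - 1))"
    unfolding P_sq_eq_matching_sum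
    by (subst sum.reindex_bij_betw[OF bij_betw_tiling_matching[OF assms], symmetric])
      (simp add: Let_def case_prod_unfold)
  also have "\<dots> = (\<Sum>(A, U)\<in>(SIGMA A:cyclic_sparse_sets n. Pow (cyclic_free_cells n A)).
      \<Prod>j\<in>U. column_weight j - 1)"
  proof (rule sum.cong, safe)
    fix A U assume "U \<subseteq> cyclic_free_cells n A"
    with fin[of A] show "(let a = z_weight n (tiling_matching n (A, U))
        in Poly_Mapping.single a (if even a then 1 else - 1)) = (\<Prod>j\<in>U. column_weight j - 1)"
      by (intro single_z_weight_tiling_matching) (auto intro: finite_subset)
  qed
  also have "\<dots> = (\<Sum>A\<in>cyclic_sparse_sets n. \<Sum>U\<in>Pow (cyclic_free_cells n A).
      \<Prod>j\<in>U. column_weight j - 1)"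
    using fin fin' by (subst sum.Sigma) auto
  \<comment> \<open>Expanding the product of \<open>(column_weight j - 1) + 1\<close> over the free
    columns gives the sum over all subsets \<open>U\<close>.\<close>
  also have "\<dots> = cyclic_tiling_sum column_weight n"
    unfolding cyclic_tiling_sum_def
    using prod_add[OF fin(1), of "\<lambda>j. column_weight j - 1" "\<lambda>_. 1"] by simp
  finally show ?thesis .
qed

subsection \<open>Waring's formula\<close>

text \<open>For \<open>n >= 1\<close> and \<open>2 * q <= n\<close> this is n/(n-q) times the
  binomial coefficient of n-q over q. The explicit 0 is necessary because truncated subtraction
  would otherwise give nonzero values.\<close>

definition waring_coeff :: "nat \<Rightarrow> nat \<Rightarrow> 'a::field_char_0" where
  "waring_coeff n q =
     (if 2 * q \<le> n then of_nat n * fact (n - q - 1) / (fact q * fact (n - 2 * q)) else 0)"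

lemma waring_coeff_0: "n \<ge> 1 \<Longrightarrow> waring_coeff n 0 = 1"
  by (cases n) (simp_all add: waring_coeff_def del: of_nat_Suc)

lemma waring_coeff_double: "waring_coeff (2 * Suc q) (Suc q) = 2"
proof -
  have e: "2 * Suc q - Suc q - 1 = q" "2 * Suc q - 2 * Suc q = 0"
    by auto
  show ?thesis
    unfolding waring_coeff_def e by (simp add: fact_Suc of_nat_mult del: of_nat_Suc mult_Suc_right)
qed

text \<open>With \<open>n = 2 * q + k\<close>, clearing factorials proves the case
  \<open>k > 0\<close>. For \<open>k = 0\<close> the middle coefficient is the default 0 and the
  other two are 2. The rule fails at \<open>n = 0\<close>, where \<open>waring_coeff 0 0\<close> is
  0.\<close>

lemma waring_coeff_rec:
  assumes "n \<ge> 1"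
  shows "(waring_coeff (n + 2) (Suc q) :: 'a::field_char_0) =
           waring_coeff (n + 1) (Suc q) + waring_coeff n q"
proof (cases "2 * q \<le> n")
  case True
  then obtain k where n: "n = 2 * q + k"
    using le_Suc_ex by blast
  show ?thesis
  proof (cases k)
    case 0
    with assms n obtain p where q: "q = Suc p"
      by (cases q) auto
    with n 0 have n': "n = 2 * Suc p" "n + 2 = 2 * Suc q"
      by auto
    have "waring_coeff (n + 1) (Suc q) = (0 :: 'a)"
      using n 0 by (simp add: waring_coeff_def)
    moreover have "waring_coeff (n + 2) (Suc q) = (2 :: 'a)"
      unfolding n'(2) by (rule waring_coeff_double)
    moreover have "waring_coeff n q = (2 :: 'a)"
      unfolding n'(1) q by (rule waring_coeff_double)
    ultimately show ?thesis
      by simp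
  next
    case (Suc l)
    have e: "2 * q + Suc l + 2 - Suc q - 1 = Suc (q + l)" "2 * q + Suc l + 2 - 2 * Suc q = Suc l"
      "2 * q + Suc l + 1 - Suc q - 1 = q + l" "2 * q + Suc l + 1 - 2 * Suc q = l"
      "2 * q + Suc l - q - 1 = q + l" "2 * q + Suc l - 2 * q = Suc l"
      "2 * Suc q \<le> 2 * q + Suc l + 2" "2 * Suc q \<le> 2 * q + Suc l + 1" "2 * q \<le> 2 * q + Suc l"
      by auto
    have nz: "(1 + of_nat l :: 'a) \<noteq> 0" "(1 + of_nat q :: 'a) \<noteq> 0"
      using of_nat_neq_0[where 'a = 'a] by (metis of_nat_Suc)+
    show ?thesis
      unfolding waring_coeff_def n Suc e
      using nz by (simp add: divide_simps) (simp add: algebra_simps)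
  qed
next
  case False
  then show ?thesis
    by (simp add: waring_coeff_def)
qed

definition waring_sum :: "'a::field_char_0 \<Rightarrow> 'a \<Rightarrow> nat \<Rightarrow> 'a" where
  "waring_sum u v n = (\<Sum>q\<le>n. waring_coeff n q * u ^ (n - 2 * q) * v ^ q)"

lemma waring_sum_rec:
  assumes "n \<ge> 1"
  shows "waring_sum u v (n + 2) = u * waring_sum u v (n + 1) + v * waring_sum u v n"
proof -
  define f where "f n q = waring_coeff n q * u ^ (n - 2 * q) * v ^ q" for n q
  have f_Suc: "f (n + 2) (Suc q) = u * f (n + 1) (Suc q) + v * f n q" for q
  proof -
    \<comment> \<open>For \<open>2 * q >= n\<close> the truncated exponents no longer match, but
      there the coefficient vanishes.\<close>
    have "waring_coeff (n + 1) (Suc q) * u ^ (n - 2 * q) =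
            u * (waring_coeff (n + 1) (Suc q) * u ^ (n + 1 - 2 * Suc q))"
    proof (cases "2 * q < n")
      case True
      then have "n - 2 * q = Suc (n + 1 - 2 * Suc q)"
        by simp
      then show ?thesis
        by (simp only: power_Suc mult_ac)
    qed (simp add: waring_coeff_def)
    then show ?thesis
      unfolding f_def waring_coeff_rec[OF assms]
      by (simp add: algebra_simps)
  qed
  have f_0: "f (n + 2) 0 = u * f (n + 1) 0"
    using assms by (simp add: f_def waring_coeff_0)
  have zero: "f m q = 0" if "q > m" for m q
    using that by (simp add: f_def waring_coeff_def)
  have "waring_sum u v (n + 2) = f (n + 2) 0 + (\<Sum>q\<le>Suc n. f (n + 2) (Suc q))"
    unfolding waring_sum_def f_def[symmetric] by (simp add: sum.atMost_Suc_shift del: sum.atMost_Suc)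
  also have "\<dots> = u * (f (n + 1) 0 + (\<Sum>q\<le>Suc n. f (n + 1) (Suc q))) + v * (\<Sum>q\<le>Suc n. f n q)"
    unfolding f_Suc f_0 sum.distrib by (simp add: algebra_simps sum_distrib_left)
  also have "f (n + 1) 0 + (\<Sum>q\<le>Suc n. f (n + 1) (Suc q)) = (\<Sum>q\<le>Suc (Suc n). f (n + 1) q)"
    by (rule sum.atMost_Suc_shift[symmetric])
  also have "\<dots> = waring_sum u v (n + 1)"
    by (simp add: waring_sum_def f_def[symmetric] zero)
  also have "(\<Sum>q\<le>Suc n. f n q) = waring_sum u v n"
    by (simp add: waring_sum_def f_def[symmetric] zero)
  finally show ?thesis .
qed

text \<open>Both sides satisfy the recursion with coefficients \<open>a + b\<close> and
  \<open>- (a * b)\<close>. The induction starts from 1 and 2, since \<open>waring_sum\<close> is 0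
  rather than 2 at \<open>n = 0\<close>.\<close>

lemma waring_formula:
  assumes "n \<ge> 1"
  shows "a ^ n + b ^ n = waring_sum (a + b) (- (a * b)) n"
  using assms
proof (induction n rule: less_induct)
  case (less n)
  consider "n = 1" | "n = 2" | m where "n = m + 2" "m \<ge> 1"
    using less.prems by (metis One_nat_def add_2_eq_Suc' le_0_eq not_less_eq_eq numeral_2_eq_2 old.nat.exhaust)
  then show ?case
  proof cases
    case 3
    then have "a ^ n + b ^ n = (a + b) * (a ^ (m + 1) + b ^ (m + 1)) - a * b * (a ^ m + b ^ m)"
      by (simp add: algebra_simps)
    also have "\<dots> = waring_sum (a + b) (- (a * b)) (m + 2)"
      using 3 less.IH[of m] less.IH[of "m + 1"] by (simp only: waring_sum_rec) simp
    finally show ?thesis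
      using 3 by simp
  qed (simp_all add: waring_sum_def waring_coeff_def numeral_2_eq_2 algebra_simps)
qed

lemma waring_sum_binomial:
  "waring_sum (1 + y) y n =
     (\<Sum>p = 0..n. y ^ p * (\<Sum>q = 0..p. if q > n - p then 0
        else of_nat n * fact (n - q - 1) / (fact q * fact (p - q) * fact (n - q - p))))"
proof -
  define t where "t p q = y ^ p * (of_nat n * fact (n - q - 1) /
    (fact q * fact (p - q) * fact (n - q - p)))" for p q
  have "waring_coeff n q * (1 + y) ^ (n - 2 * q) * y ^ q = (\<Sum>p \<in> {p. p \<le> n \<and> q \<le> p \<and> q \<le> n - p}. t p q)"
    if "q \<le> n" for q
  proof (cases "2 * q \<le> n")
    case True
    have "waring_coeff n q * (1 + y) ^ (n - 2 * q) * y ^ q =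
      (\<Sum>i\<le>n - 2 * q. waring_coeff n q * of_nat ((n - 2 * q) choose i) * y ^ (i + q))"
      by (simp add: binomial_ring[of y 1, simplified add.commute] sum_distrib_left sum_distrib_right
          power_add mult_ac)
    \<comment> \<open>The binomial theorem is reindexed by \<open>p = i + q\<close>; the factor
      \<open>fact (n - 2 * q)\<close> cancels, and \<open>i <= n - 2 * q\<close> becomes
      \<open>q <= n - p\<close>.\<close>
    also have "\<dots> = (\<Sum>i\<le>n - 2 * q. t (i + q) q)"
    proof (rule sum.cong)
      fix i assume "i \<in> {..n - 2 * q}"
      then have i: "i \<le> n - 2 * q" by simp
      have e: "n - q - (i + q) = n - 2 * q - i" "i + q - q = i"
        by auto
      show "waring_coeff n q * of_nat ((n - 2 * q) choose i) * y ^ (i + q) = t (i + q) q"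
        unfolding t_def e binomial_fact[OF i] waring_coeff_def using True
        by (simp add: mult_ac)
    qed simp
    also have "\<dots> = (\<Sum>p \<in> {p. p \<le> n \<and> q \<le> p \<and> q \<le> n - p}. t p q)"
      using True
      by (intro sum.reindex_bij_witness[of _ "\<lambda>p. p - q" "\<lambda>i. i + q"]) auto
    finally show ?thesis .
  next
    case False
    then have "{p. p \<le> n \<and> q \<le> p \<and> q \<le> n - p} = {}"
      by auto
    with False show ?thesis
      unfolding waring_coeff_def by (simp only: sum.empty) simp
  qed
  then have "waring_sum (1 + y) y n =
      (\<Sum>q\<le>n. \<Sum>p \<in> {p. p \<in> {..n} \<and> q \<le> p \<and> q \<le> n - p}. t p q)"
    unfolding waring_sum_def by simp
  also have "\<dots> = (\<Sum>p\<le>n. \<Sum>q \<in> {q. q \<in> {..n} \<and> q \<le> p \<and> q \<le> n - p}. t p q)"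
    by (rule sum.swap_restrict) auto
  also have "\<dots> = (\<Sum>p\<le>n. \<Sum>q = 0..p. if q > n - p then 0 else t p q)"
    by (intro sum.cong sum.mono_neutral_cong_left) auto
  also have "\<dots> = (\<Sum>p = 0..n. y ^ p * (\<Sum>q = 0..p. if q > n - p then 0
        else of_nat n * fact (n - q - 1) / (fact q * fact (p - q) * fact (n - q - p))))"
    by (auto simp: atLeast0AtMost sum_distrib_left t_def intro!: sum.cong)
  finally show ?thesis .
qed

subsection \<open>Evaluation of Laurent polynomials\<close>

text \<open>Allows several Laurent polynomials to be evaluated over a common finite set of
  exponents.\<close>

lemma laurent_eval_superset:
  assumes "finite S" "Poly_Mapping.keys p \<subseteq> S"
  shows "laurent_eval p z = (\<Sum>k\<in>S. of_int (Poly_Mapping.lookup p k) * z powi k)"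
  unfolding laurent_eval_def
  using assms by (intro sum.mono_neutral_left) (auto simp: in_keys_iff)

lemma laurent_eval_single: "laurent_eval (Poly_Mapping.single k c) z = of_int c * z powi k"
  by (subst laurent_eval_superset[of "{k}"]) (auto simp: lookup_single)

lemma laurent_eval_add: "laurent_eval (p + q) z = laurent_eval p z + laurent_eval q z"
  using keys_add[of p q]
  by (simp add: laurent_eval_superset[of "Poly_Mapping.keys p \<union> Poly_Mapping.keys q"]
      lookup_add distrib_right sum.distrib)

lemma laurent_eval_uminus: "laurent_eval (- p) z = - laurent_eval p z"
  by (simp add: laurent_eval_def sum_negf)

lemma laurent_eval_diff: "laurent_eval (p - q) z = laurent_eval p z - laurent_eval q z"
  using laurent_eval_add[of p "- q"] by (simp add: laurent_eval_uminus)

text \<open>Induction on the number of terms: updating at a fresh key adds a monomial. For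
  \<open>z = 0\<close> exponents would not add under \<open>powi\<close>.\<close>

lemma laurent_eval_mult_single:
  assumes "z \<noteq> 0"
  shows "laurent_eval (p * Poly_Mapping.single k c) z = laurent_eval p z * (of_int c * z powi k)"
proof (induction p rule: update_induct)
  case const
  then show ?case
    by (simp add: laurent_eval_def)
next
  case (update f a b)
  have "Poly_Mapping.update a b f = f + Poly_Mapping.single a b"
    using update by (intro poly_mapping_eqI)
      (auto simp: lookup_update lookup_add lookup_single in_keys_iff when_def)
  with update assms show ?case
    by (simp add: distrib_right laurent_eval_add mult_single laurent_eval_single power_int_add)
qed

lemma laurent_eval_mult:
  assumes "z \<noteq> 0"
  shows "laurent_eval (p * q) z = laurent_eval p z * laurent_eval q z"
proof (induction q rule: update_induct)
  case const
  then show ?case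
    by (simp add: laurent_eval_def)
next
  case (update f a b)
  have "Poly_Mapping.update a b f = f + Poly_Mapping.single a b"
    using update by (intro poly_mapping_eqI)
      (auto simp: lookup_update lookup_add lookup_single in_keys_iff when_def)
  with update assms show ?case
    by (simp add: distrib_left laurent_eval_add laurent_eval_mult_single laurent_eval_single)
qed

lemma laurent_eval_numeral: "laurent_eval (numeral k) z = numeral k"
  using laurent_eval_single[of 0 "numeral k" z] by simp

subsection \<open>The recursion and its solutions\<close>

lemma P_sq_0: "P_sq 0 = 1"
proof -
  have "{M. perfect_matching 0 M \<and> w_weight 0 M = 0} = {{}}"
    by (auto simp: perfect_matching_def strip_edges_def strip_nodes_def w_weight_def)
  then show ?thesis
    by (simp add: P_sq_eq_matching_sum z_weight_def)
qed

lemma P_sq_2: "P_sq 2 = 4 - Z - Z_inv"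
proof -
  \<comment> \<open>The two column weights multiply to \<open>2 - Z - Z_inv\<close>; the two
    dominoes supply the remaining 2.\<close>
  have "Z * Z_inv = 1"
    by (simp add: Z_def Z_inv_def mult_single)
  then show ?thesis
    by (simp add: P_sq_eq_cyclic_tiling_sum cyclic_tiling_sum_2 column_weight_def algebra_simps)
qed

lemma P_sq_rec:
  assumes "even n" "n \<ge> 4"
  shows "P_sq n = P_sq 2 * P_sq (n - 2) - (if n = 4 then 2 else P_sq (n - 4))"
proof -
  have "n \<noteq> 4 \<Longrightarrow> n - 4 \<ge> 2"
    using assms by presburger
  moreover have "n \<ge> 2" "n - 2 \<ge> 2"
    using assms by auto
  ultimately show ?thesis
    using cyclic_tiling_sum_rec[OF assms, of column_weight]
    by (auto simp: P_sq_eq_cyclic_tiling_sum column_weight_def)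
qed

text \<open>The power sums of \<open>a\<close> and \<open>b\<close> obey the same recursion, and the
  exceptional 2 at \<open>n = 4\<close> is \<open>a ^ 0 + b ^ 0\<close>.\<close>

lemma laurent_eval_P_sq:
  assumes "even n" "n \<ge> 2" "z \<noteq> 0" and sum: "a + b = 4 - z - 1 / z" and prod: "a * b = 1"
  shows "laurent_eval (P_sq n) z = a ^ (n div 2) + b ^ (n div 2)"
  using assms(1,2)
proof (induction n rule: less_induct)
  case (less n)
  have P2: "laurent_eval (P_sq 2) z = a + b"
    unfolding P_sq_2 sum laurent_eval_diff laurent_eval_numeral Z_def Z_inv_def laurent_eval_single
    by (simp add: power_int_minus inverse_eq_divide)
  show ?case
  proof (cases "n = 2")
    case False
    with less.prems have "n \<ge> 4"
      by presburger
    define m where "m = (n - 4) div 2"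
    have n: "n = 2 * m + 4"
      using less.prems(1) \<open>n \<ge> 4\<close> by (auto simp: m_def)
    have "laurent_eval (if n = 4 then 2 else P_sq (n - 4)) z = a ^ m + b ^ m"
      using less.IH[of "n - 4"] by (auto simp: n laurent_eval_numeral)
    moreover have "laurent_eval (P_sq (n - 2)) z = a ^ (m + 1) + b ^ (m + 1)"
      using less.IH[of "n - 2"] by (auto simp: n)
    ultimately have "laurent_eval (P_sq n) z =
        (a + b) * (a ^ (m + 1) + b ^ (m + 1)) - a * b * (a ^ m + b ^ m)"
      unfolding P_sq_rec[OF less.prems(1) \<open>n \<ge> 4\<close>] laurent_eval_diff
        laurent_eval_mult[OF assms(3)] P2 prod by simp
    also have "\<dots> = a ^ (m + 2) + b ^ (m + 2)"
      by (simp add: algebra_simps)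
    finally show ?thesis
      by (simp add: n)
  qed (simp add: P2)
qed

(* The recursion holds at n = 4 only with the value 2 in place of P_sq 0 = 1 (2 is also the
   value of the first closed form at n = 0), and the double sum needs the prefactor
   (-z)^(-n/2): with z^(-n/2) it would give z - 4 + 1/z for n = 2. *)
theorem mainTheorem5:
  shows "P_sq 0 = 1
    \<and> P_sq 2 = 4 - Z - Z_inv
    \<and> (\<forall>n::nat. even n \<and> 4 \<le> n \<longrightarrow>
          P_sq n = P_sq 2 * P_sq (n - 2) - (if n = 4 then 2 else P_sq (n - 4)))
    \<and> (\<forall>(n::nat) (z::complex). even n \<and> 2 \<le> n \<and> z \<noteq> 0 \<longrightarrow>
          laurent_eval (P_sq n) z =
            1 / (- 4 * z) ^ (n div 2) *
              ((z - 1 - csqrt (1 + z * (z - 6))) ^ n + (z - 1 + csqrt (1 + z * (z - 6))) ^ n)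
        \<and> laurent_eval (P_sq n) z =
            1 / (- z) ^ (n div 2) *
              (\<Sum>p = 0..n. (- 1) ^ p * z ^ p *
                (\<Sum>q = 0..p. if q > n - p then 0
                   else of_nat n * fact (n - q - 1) /
                        (fact q * fact (p - q) * fact (n - q - p)))))"
proof (intro conjI allI impI)
  fix n :: nat and z :: complex
  assume "even n \<and> 2 \<le> n \<and> z \<noteq> 0"
  then have n: "even n" "2 \<le> n" and z: "z \<noteq> 0"
    by auto
  define s where "s = csqrt (1 + z * (z - 6))"
  have s2: "s * s = 1 + z * (z - 6)"
    unfolding s_def by (metis power2_csqrt power2_eq_square)
  \<comment> \<open>Squaring turns an \<open>n\<close>-th power into a power with exponent
    \<open>n div 2\<close>, and dividing by \<open>- 4 * z\<close> normalises the product to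
    1.\<close>
  define a where "a = (z - 1 - s)\<^sup>2 / (- 4 * z)"
  define b where "b = (z - 1 + s)\<^sup>2 / (- 4 * z)"
  have "(z - 1 - s) * (z - 1 + s) = (z - 1)\<^sup>2 - s * s"
    by (simp add: power2_eq_square algebra_simps)
  also have "\<dots> = 4 * z"
    unfolding s2 by (simp add: power2_eq_square algebra_simps)
  finally have prod: "(z - 1 - s) * (z - 1 + s) = 4 * z" .
  have "a * b = ((z - 1 - s) * (z - 1 + s))\<^sup>2 / (4 * z)\<^sup>2"
    by (simp add: a_def b_def power2_eq_square)
  then have ab: "a * b = 1"
    unfolding prod using z by simp
  have "(z - 1 - s)\<^sup>2 + (z - 1 + s)\<^sup>2 = 2 * (z - 1)\<^sup>2 + 2 * (s * s)"
    by (simp add: power2_eq_square algebra_simps)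
  also have "\<dots> = (- 4 * z) * (4 - z - 1 / z)"
    unfolding s2 using z by (simp add: power2_eq_square algebra_simps)
  finally have "a + b = 4 - z - 1 / z"
    unfolding a_def b_def add_divide_distrib[symmetric] using z by simp
  then have "laurent_eval (P_sq n) z = a ^ (n div 2) + b ^ (n div 2)"
    using laurent_eval_P_sq[OF n z] ab by blast
  also have "\<dots> = 1 / (- 4 * z) ^ (n div 2) * ((z - 1 - s) ^ n + (z - 1 + s) ^ n)"
    using n(1) unfolding a_def b_def power_divide
    by (simp add: power_mult[symmetric] add_divide_distrib)
  finally show closed: "laurent_eval (P_sq n) z = 1 / (- 4 * z) ^ (n div 2) *
      ((z - 1 - csqrt (1 + z * (z - 6))) ^ n + (z - 1 + csqrt (1 + z * (z - 6))) ^ n)"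
    unfolding s_def .
  \<comment> \<open>This scaling gives \<open>c + d = 1 - z\<close> and \<open>c * d = z\<close>, so
    Waring's formula has the shape \<open>waring_sum (1 + y) y\<close> with
    \<open>y = - z\<close>.\<close>
  define c where "c = - (z - 1 - s) / 2"
  define d where "d = - (z - 1 + s) / 2"
  have "c * d = ((z - 1 - s) * (z - 1 + s)) / 4"
    by (simp add: c_def d_def algebra_simps)
  then have "- (c * d) = - z"
    unfolding prod by simp
  moreover have "c + d = 1 + - z"
    by (simp add: c_def d_def field_simps)
  ultimately have "c ^ n + d ^ n = waring_sum (1 + - z) (- z) n"
    using waring_formula[of n c d] n(2) by simp
  moreover have "(z - 1 - s) ^ n + (z - 1 + s) ^ n = 2 ^ n * (c ^ n + d ^ n)"
  proof -
    have "z - 1 - s = - (2 * c)" "z - 1 + s = - (2 * d)"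
      by (simp_all add: c_def d_def field_simps)
    then show ?thesis
      using n(1) by (simp only: power_minus_even power_mult_distrib distrib_left)
  qed
  \<comment> \<open>The factor \<open>2 ^ n\<close> cancels against the one from the rescaling to
    \<open>c\<close> and \<open>d\<close>, which leaves the prefactor with base
    \<open>- z\<close>.\<close>
  moreover have "(- 4 * z) ^ (n div 2) = 2 ^ n * (- z) ^ (n div 2)"
  proof -
    obtain m where m: "n = 2 * m"
      using n(1) by (rule evenE)
    have "(- 4 * z) ^ m = (2\<^sup>2 * - z) ^ m"
      by simp
    also have "\<dots> = 2 ^ n * (- z) ^ m"
      unfolding m by (simp only: power_mult_distrib power_mult)
    finally show ?thesis
      by (simp add: m)
  qed
  ultimately have "laurent_eval (P_sq n) z = 1 / (- z) ^ (n div 2) * waring_sum (1 + - z) (- z) n"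
    using closed unfolding s_def[symmetric] by simp
  then show "laurent_eval (P_sq n) z = 1 / (- z) ^ (n div 2) *
      (\<Sum>p = 0..n. (- 1) ^ p * z ^ p * (\<Sum>q = 0..p. if q > n - p then 0
         else of_nat n * fact (n - q - 1) / (fact q * fact (p - q) * fact (n - q - p))))"
    unfolding waring_sum_binomial power_minus[of z] .
qed (use P_sq_0 P_sq_2 P_sq_rec in auto)

end
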